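(* Let $1<p<q<\infty$ and $1<r<\infty$, and let $p',q',r'$ be the conjugate exponents. Then the map $$x\in\ell^p_{q,r}(\mathbb Z)\longmapsto L_x\in\big(\mathrm h^{p'}_{q',r'}(\mathbb Z)\big)^*,\qquad L_x(y)=\sum_{m\in\mathbb Z}x(m)y(m),$$ is a linear isometric isomorphism. In particular, every bounded linear functional on $\mathrm h^{p'}_{q',r'}(\mathbb Z)$ is of the form $L_x$ for a unique $x\in\ell^p_{q,r}(\mathbb Z)$, and $\|L_x\|=\|x\|_{\ell^p_{q,r}}$.
   Context: For $j\in\mathbb N_0=\{0,1,2,\dots\}$ and $k\in\mathbb Z$ let $I(j,k)=[2^jk,2^j(k+1))\cap\mathbb Z$, with $|I(j,k)|=2^j$ elements; these are the dyadic intervals. All sequences are real. For a sequence $x\in\mathbb R^{\mathbb Z}$ put $$\|x\|_{\ell^p_{q,r}}=\Big(\sum_{j=0}^\infty\sum_{k\in\mathbb Z}(2^j)^{r(\frac1q-\frac1p)}\Big(\sum_{l\in I(j,k)}|x(l)|^p\Big)^{r/p}\Big)^{1/r},$$ and let $\ell^p_{q,r}(\mathbb Z)$ be the space of all $x$ with $\|x\|_{\ell^p_{q,r}}<\infty$. A $(q',p')$-block with respect to a dyadic interval $I$ is a sequence $a\in\mathbb R^{\mathbb Z}$ with $\operatorname{supp}a\subset I$ and $\|a\|_{\ell^{p'}}\le|I|^{\frac1{p'}-\frac1{q'}}$. The block space $\mathrm h^{p'}_{q',r'}(\mathbb Z)$ is the set of all $y\in\mathbb R^{\mathbb Z}$ that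 can be written as $$y=\sum_{(j,k)\in\mathbb N_0\times\mathbb Z}\lambda^j_k a^j_k,$$ with $\lambda=(\lambda^j_k)\in\ell^{r'}(\mathbb N_0\times\mathbb Z)$ and each $a^j_k$ a $(q',p')$-block with respect to $I(j,k)$, the series converging in $\ell^1_{\mathrm{loc}}$ (i.e. in $\ell^1$ on every finite subset of $\mathbb Z$). Its norm is $\|y\|_{\mathrm h^{p'}_{q',r'}}=\inf\|\lambda\|_{\ell^{r'}}$, the infimum being over all such representations. *)

theory Defs
  imports "HOL-Analysis.Analysis"
begin

definition dyadic :: "nat \<Rightarrow> int \<Rightarrow> int set" where
  "dyadic j k = {2 ^ j * k ..< 2 ^ j * (k + 1)}"

definition lp_space :: "real \<Rightarrow> ('i \<Rightarrow> real) set" where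
  "lp_space s = {u. (\<lambda>i. \<bar>u i\<bar> powr s) summable_on UNIV}"

definition lp_norm :: "real \<Rightarrow> ('i \<Rightarrow> real) \<Rightarrow> real" where
  "lp_norm s u = (\<Sum>\<^sub>\<infinity>i. \<bar>u i\<bar> powr s) powr (1 / s)"

text \<open>
  The double sum over \<open>j\<close> and \<open>k\<close> has nonnegative terms, so it is taken as one unordered sum
  over pairs; the norm is finite exactly if this sum converges, which is the membership
  condition of \<open>bm_space\<close> (\<open>bm_norm\<close> is only meaningful there).
\<close>

definition bm_term :: "real \<Rightarrow> real \<Rightarrow> real \<Rightarrow> (int \<Rightarrow> real) \<Rightarrow> nat \<times> int \<Rightarrow> real" where
  "bm_term p q r x = (\<lambda>(j, k).
     (2 ^ j) powr (r * (1 / q - 1 / p)) * (\<Sum>l\<in>dyadic j k. \<bar>x l\<bar> powr p) powr (r / p))"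

definition bm_space :: "real \<Rightarrow> real \<Rightarrow> real \<Rightarrow> (int \<Rightarrow> real) set" where
  "bm_space p q r = {x. bm_term p q r x summable_on UNIV}"

definition bm_norm :: "real \<Rightarrow> real \<Rightarrow> real \<Rightarrow> (int \<Rightarrow> real) \<Rightarrow> real" where
  "bm_norm p q r x = (\<Sum>\<^sub>\<infinity>jk. bm_term p q r x jk) powr (1 / r)"

text \<open>
  \<open>is_block q p I a\<close> says that \<open>a\<close> is a \<open>(q,p)\<close>-block. It is only used for finite \<open>I\<close>, where the
  support condition makes the sum in \<open>lp_norm p a\<close> finite.
\<close>

definition is_block :: "real \<Rightarrow> real \<Rightarrow> int set \<Rightarrow> (int \<Rightarrow> real) \<Rightarrow> bool" where
  "is_block q p I a \<longleftrightarrow>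
     {m. a m \<noteq> 0} \<subseteq> I \<and> lp_norm p a \<le> real (card I) powr (1 / p - 1 / q)"

text \<open>The last conjunct is convergence in \<open>\<ell>\<^sup>1\<^sub>l\<^sub>o\<^sub>c\<close> of the net of finite partial sums.\<close>

definition block_rep ::
  "real \<Rightarrow> real \<Rightarrow> real \<Rightarrow> (nat \<times> int \<Rightarrow> real) \<Rightarrow> (nat \<times> int \<Rightarrow> int \<Rightarrow> real) \<Rightarrow> (int \<Rightarrow> real) \<Rightarrow> bool"
  where
  "block_rep p q r c a y \<longleftrightarrow>
     c \<in> lp_space r \<and>
     (\<forall>j k. is_block q p (dyadic j k) (a (j, k))) \<and>
     (\<forall>F. finite F \<longrightarrow>
        ((\<lambda>S. \<Sum>m\<in>F. \<bar>(\<Sum>jk\<in>S. c jk * a jk m) - y m\<bar>) \<longlongrightarrow> 0)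
          (finite_subsets_at_top UNIV))"

definition block_space :: "real \<Rightarrow> real \<Rightarrow> real \<Rightarrow> (int \<Rightarrow> real) set" where
  "block_space p q r = {y. \<exists>c a. block_rep p q r c a y}"

definition block_norm :: "real \<Rightarrow> real \<Rightarrow> real \<Rightarrow> (int \<Rightarrow> real) \<Rightarrow> real" where
  "block_norm p q r y = Inf {lp_norm r c | c a. block_rep p q r c a y}"

definition fun_normed_space :: "('a \<Rightarrow> real) set \<Rightarrow> (('a \<Rightarrow> real) \<Rightarrow> real) \<Rightarrow> bool" where
  "fun_normed_space V N \<longleftrightarrow>
     (\<lambda>_. 0) \<in> V \<and>
     (\<forall>x\<in>V. \<forall>y\<in>V. (\<lambda>t. x t + y t) \<in> V \<and> N (\<lambda>t. x t + y t) \<le> N x + N y) \<and>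
     (\<forall>c. \<forall>x\<in>V. (\<lambda>t. c * x t) \<in> V \<and> N (\<lambda>t. c * x t) = \<bar>c\<bar> * N x) \<and>
     (\<forall>x\<in>V. 0 \<le> N x \<and> (N x = 0 \<longleftrightarrow> x = (\<lambda>_. 0)))"

definition fun_linear_on ::
  "('a \<Rightarrow> real) set \<Rightarrow> (('a \<Rightarrow> real) \<Rightarrow> 'b \<Rightarrow> real) \<Rightarrow> bool" where
  "fun_linear_on V T \<longleftrightarrow>
     (\<forall>x\<in>V. \<forall>y\<in>V. T (\<lambda>t. x t + y t) = (\<lambda>s. T x s + T y s)) \<and>
     (\<forall>c. \<forall>x\<in>V. T (\<lambda>t. c * x t) = (\<lambda>s. c * T x s))"

definition bounded_functional_on ::
  "('a \<Rightarrow> real) set \<Rightarrow> (('a \<Rightarrow> real) \<Rightarrow> real) \<Rightarrow> (('a \<Rightarrow> real) \<Rightarrow> real) \<Rightarrow> bool" where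
  "bounded_functional_on V N F \<longleftrightarrow>
     (\<forall>x\<in>V. \<forall>y\<in>V. F (\<lambda>t. x t + y t) = F x + F y) \<and>
     (\<forall>c. \<forall>x\<in>V. F (\<lambda>t. c * x t) = c * F x) \<and>
     (\<exists>C. \<forall>x\<in>V. \<bar>F x\<bar> \<le> C * N x)"

text \<open>
  Functionals on \<open>V\<close> are represented by total functions; the value 0 outside \<open>V\<close> makes the
  representation unique and keeps the dual closed under pointwise operations.
\<close>

definition dual_space ::
  "('a \<Rightarrow> real) set \<Rightarrow> (('a \<Rightarrow> real) \<Rightarrow> real) \<Rightarrow> (('a \<Rightarrow> real) \<Rightarrow> real) set" where
  "dual_space V N = {F. bounded_functional_on V N F \<and> (\<forall>x. x \<notin> V \<longrightarrow> F x = 0)}"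

definition dual_norm ::
  "('a \<Rightarrow> real) set \<Rightarrow> (('a \<Rightarrow> real) \<Rightarrow> real) \<Rightarrow> (('a \<Rightarrow> real) \<Rightarrow> real) \<Rightarrow> real" where
  "dual_norm V N F = (SUP x\<in>{x \<in> V. N x \<le> 1}. \<bar>F x\<bar>)"

definition linear_isometric_isomorphism ::
  "('a \<Rightarrow> real) set \<Rightarrow> (('a \<Rightarrow> real) \<Rightarrow> real) \<Rightarrow>
   ('b \<Rightarrow> real) set \<Rightarrow> (('b \<Rightarrow> real) \<Rightarrow> real) \<Rightarrow> (('a \<Rightarrow> real) \<Rightarrow> 'b \<Rightarrow> real) \<Rightarrow> bool" where
  "linear_isometric_isomorphism V N W M T \<longleftrightarrow>
     fun_normed_space V N \<and> fun_normed_space W M \<and>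
     fun_linear_on V T \<and> bij_betw T V W \<and> (\<forall>x\<in>V. M (T x) = N x)"

definition pairing_functional :: "(int \<Rightarrow> real) set \<Rightarrow> (int \<Rightarrow> real) \<Rightarrow> (int \<Rightarrow> real) \<Rightarrow> real" where
  "pairing_functional V x y = (if y \<in> V then \<Sum>\<^sub>\<infinity>m. x m * y m else 0)"

end

theory Submission
  imports Defs
begin

text \<open>
  Write \<open>w I = |I| powr (1 / q - 1 / p)\<close> for a dyadic interval \<open>I\<close>. In \<open>bm_space p q r\<close>
  the norm of \<open>x\<close> is the \<open>\<ell>\<^sup>r\<close> norm of the family \<open>t I = w I * \<parallel>x\<parallel>\<close>, where \<open>\<parallel>x\<parallel>\<close> is taken in \<open>\<ell>\<^sup>p(I)\<close>
  (lemma \<open>bm_norm_eq\<close>): the restrictions of \<open>x\<close> to the dyadic intervals embed this space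
  isometrically into a weighted \<open>\<ell>\<^sup>r(\<ell>\<^sup>p)\<close>. Dually, absorbing the coefficients into the blocks,
  the elements of the block space are the sums of pieces \<open>g I\<close> supported in \<open>I\<close> whose
  norm with exponent \<open>p'\<close> is at most \<open>d I * w I\<close>, with \<open>d\<close> summable to the power \<open>r'\<close>; the
  block norm is the infimum of the norms of \<open>d\<close>. This is a quotient of the predual of that
  weighted \<open>\<ell>\<^sup>r(\<ell>\<^sup>p)\<close>, which is why the two spaces should be dual to each other.

  Hoelder's inequality on each interval and then over all intervals gives
  \<open>\<bar>L x y\<bar> \<le> \<parallel>x\<parallel> * \<parallel>y\<parallel>\<close> (lemma \<open>pairing_le\<close>).

  Conversely, let \<open>F\<close> be a functional with \<open>\<bar>F y\<bar> \<le> C * \<parallel>y\<parallel>\<close> and put \<open>x m = F \<delta>\<close>, with \<open>\<delta>\<close> the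
  point mass at \<open>m\<close>. For a finite family \<open>S\<close> of intervals, equality cases of Hoelder's inequality
  are used twice: on each interval they give a block \<open>b I\<close> that pairs with \<open>x\<close> to \<open>t I\<close>, and
  over \<open>S\<close> they give coefficients \<open>c\<close> of norm at most 1 with \<open>\<Sum>I\<in>S. c I * t I\<close> equal to the
  \<open>\<ell>\<^sup>r\<close> norm of \<open>t\<close> on \<open>S\<close>. The combination of the \<open>b I\<close> with coefficients \<open>c\<close> has block norm at
  most 1, and \<open>F\<close> maps it to that \<open>\<ell>\<^sup>r\<close> norm; hence \<open>\<parallel>x\<parallel> \<le> C\<close>
  (lemma \<open>functional_coefficients\<close>). Since \<open>r'\<close> is finite, finite sums of pieces are dense in the
  block space, so \<open>F\<close> and \<open>L x\<close>, which agree on point masses, agree everywhere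
  (lemmas \<open>functional_vanishes\<close> and \<open>functional_representation\<close>). Applied to \<open>F = L x\<close> with the dual norm
  of \<open>L x\<close> as \<open>C\<close>, the same bound shows that \<open>x \<mapsto> L x\<close> does not decrease norms.

  The hypothesis \<open>p < q\<close> makes the weights decay geometrically in the scale, so that point
  masses lie in \<open>bm_space p q r\<close> (lemma \<open>point_mass_in_bm_space\<close>). Pairing with them shows that
  an element of block norm 0 vanishes, and so that the block norm is a norm.
\<close>

section \<open>Hoelder and Minkowski inequalities for \<open>\<ell>\<^sup>s\<close>\<close>

definition sum_norm :: "real \<Rightarrow> 'i set \<Rightarrow> ('i \<Rightarrow> real) \<Rightarrow> real" where
  "sum_norm s A u = (\<Sum>i\<in>A. \<bar>u i\<bar> powr s) powr (1 / s)"

lemma conjugate_exponent_gt_1: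
  fixes s s' :: real
  assumes "1 < s" "1 / s + 1 / s' = 1"
  shows "1 < s'"
proof -
  have "0 < 1 / s" "1 / s < 1" using assms(1) by auto
  then have "0 < 1 / s'" "1 / s' < 1" using assms(2) by linarith+
  then show ?thesis by (auto simp: divide_less_eq split: if_splits)
qed

lemma sum_norm_nonneg [simp]: "0 \<le> sum_norm s A u"
  by (simp add: sum_norm_def)

lemma sum_norm_zero [simp]: "sum_norm s A (\<lambda>_. 0) = 0"
  by (simp add: sum_norm_def)

lemma sum_norm_powr:
  assumes "0 < s"
  shows "sum_norm s A u powr s = (\<Sum>i\<in>A. \<bar>u i\<bar> powr s)"
  using assms by (simp add: sum_norm_def powr_powr sum_nonneg)

lemma sum_norm_scale:
  assumes "0 < s"
  shows "sum_norm s A (\<lambda>i. c * u i) = \<bar>c\<bar> * sum_norm s A u"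
proof -
  have "(\<Sum>i\<in>A. \<bar>c * u i\<bar> powr s) = \<bar>c\<bar> powr s * (\<Sum>i\<in>A. \<bar>u i\<bar> powr s)"
    by (simp add: abs_mult powr_mult sum_distrib_left)
  then show ?thesis
    using assms by (simp add: sum_norm_def powr_mult sum_nonneg powr_powr)
qed

lemma sum_norm_eq_0D:
  assumes "finite A" "0 < s" "sum_norm s A u = 0" "i \<in> A"
  shows "u i = 0"
proof -
  have "(\<Sum>i\<in>A. \<bar>u i\<bar> powr s) = 0"
    using sum_norm_powr[OF assms(2), of A u] assms(2,3) by simp
  then show ?thesis
    using assms(1,4) by (simp add: sum_nonneg_eq_0_iff)
qed

lemma sum_norm_cong: "(\<And>i. i \<in> A \<Longrightarrow> \<bar>u i\<bar> = \<bar>v i\<bar>) \<Longrightarrow> sum_norm s A u = sum_norm s A v"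
  by (simp add: sum_norm_def)

lemma sum_norm_mono:
  assumes "0 < s" "\<And>i. i \<in> A \<Longrightarrow> \<bar>u i\<bar> \<le> \<bar>v i\<bar>"
  shows "sum_norm s A u \<le> sum_norm s A v"
  unfolding sum_norm_def using assms
  by (intro powr_mono2 sum_mono sum_nonneg) auto

text \<open>
  After normalising both factors to norm 1, this is Young's inequality summed over the index
  set.
\<close>

lemma Holder_sum:
  fixes u v :: "'i \<Rightarrow> real"
  assumes "finite A" and s: "1 < s" "1 / s + 1 / s' = 1"
  shows "(\<Sum>i\<in>A. \<bar>u i * v i\<bar>) \<le> sum_norm s A u * sum_norm s' A v"
proof -
  have s': "1 < s'" using conjugate_exponent_gt_1[OF s] .
  let ?U = "sum_norm s A u" and ?V = "sum_norm s' A v"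
  show ?thesis
  proof (cases "?U = 0 \<or> ?V = 0")
    case True
    then have "u i * v i = 0" if "i \<in> A" for i
      using sum_norm_eq_0D[OF assms(1) _ _ that, of s u] sum_norm_eq_0D[OF assms(1) _ _ that, of s' v]
        s s' by (elim disjE) simp_all
    then have "(\<Sum>i\<in>A. \<bar>u i * v i\<bar>) = 0" by (intro sum.neutral) simp
    then show ?thesis by simp
  next
    case False
    then have pos: "0 < ?U" "0 < ?V"
      using sum_norm_nonneg[of s A u] sum_norm_nonneg[of s' A v] by linarith+
    have "(\<Sum>i\<in>A. \<bar>u i * v i\<bar>) / (?U * ?V) = (\<Sum>i\<in>A. (\<bar>u i\<bar> / ?U) * (\<bar>v i\<bar> / ?V))"
      by (simp add: sum_divide_distrib abs_mult)
    also have "\<dots> \<le> (\<Sum>i\<in>A. (\<bar>u i\<bar> / ?U) powr s / s + (\<bar>v i\<bar> / ?V) powr s' / s')"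
      using s s' pos by (intro sum_mono Youngs_inequality) auto
    also have "\<dots> = (\<Sum>i\<in>A. \<bar>u i\<bar> powr s) / ?U powr s / s
                     + (\<Sum>i\<in>A. \<bar>v i\<bar> powr s') / ?V powr s' / s'"
      using pos by (simp add: sum.distrib powr_divide sum_divide_distrib)
    also have "\<dots> = 1 / s + 1 / s'"
    proof -
      have "?U powr s \<noteq> 0" "?V powr s' \<noteq> 0" using pos by auto
      then show ?thesis
        using s(1) s' sum_norm_powr[of s A u] sum_norm_powr[of s' A v] by simp
    qed
    finally show ?thesis
      using pos s(2) by (simp add: pos_divide_le_eq)
  qed
qed

text \<open>
  Equality in Hoelder's inequality holds for the vector proportional to
  \<open>sgn u * \<bar>u\<bar> powr (s - 1)\<close>. The zero vector serves when \<open>u\<close> vanishes on \<open>A\<close>, hence the bound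
  by 1 instead of an equality.
\<close>

lemma sum_norm_dual_vector:
  fixes u :: "'i \<Rightarrow> real"
  assumes "finite A" and s: "1 < s" "1 / s + 1 / s' = 1"
  obtains v where "\<And>i. i \<notin> A \<Longrightarrow> v i = 0" "(\<Sum>i\<in>A. u i * v i) = sum_norm s A u"
    "sum_norm s' A v \<le> 1"
proof (cases "sum_norm s A u = 0")
  case True
  then show ?thesis by (intro that[of "\<lambda>_. 0"]) auto
next
  case False
  let ?N = "sum_norm s A u"
  have N: "0 < ?N" using False sum_norm_nonneg[of s A u] by linarith
  have s': "1 < s'" using conjugate_exponent_gt_1[OF s] .
  have ss: "(s - 1) * s' = s" using s s' by (simp add: field_simps)
  have NN: "?N powr s = (\<Sum>i\<in>A. \<bar>u i\<bar> powr s)" using s by (simp add: sum_norm_powr)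
  define v where "v i = (if i \<in> A then sgn (u i) * \<bar>u i\<bar> powr (s - 1) / ?N powr (s - 1) else 0)" for i
  have abs_v: "\<bar>v i\<bar> powr s' = \<bar>u i\<bar> powr s / ?N powr s" if "i \<in> A" for i
  proof (cases "u i = 0")
    case True
    then show ?thesis using that by (simp add: v_def)
  next
    case False
    then have "\<bar>v i\<bar> = \<bar>u i\<bar> powr (s - 1) / ?N powr (s - 1)"
      using that by (simp add: v_def abs_mult abs_sgn_eq)
    then show ?thesis by (simp add: powr_divide powr_powr ss)
  qed
  have uv: "u i * v i = \<bar>u i\<bar> powr s / ?N powr (s - 1)" if "i \<in> A" for i
  proof (cases "u i = 0")
    case False
    have "\<bar>u i\<bar> powr s = \<bar>u i\<bar> * \<bar>u i\<bar> powr (s - 1)"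
      using False by (simp add: powr_mult_base)
    also have "\<dots> = u i * sgn (u i) * \<bar>u i\<bar> powr (s - 1)"
      by (simp add: abs_sgn)
    finally show ?thesis using that by (simp add: v_def)
  qed (simp add: that v_def)
  show ?thesis
  proof (rule that[of v])
    show "(\<Sum>i\<in>A. u i * v i) = ?N"
    proof -
      have "(\<Sum>i\<in>A. u i * v i) = ?N powr s / ?N powr (s - 1)"
        by (simp add: uv NN sum_divide_distrib)
      also have "\<dots> = ?N" using N by (simp flip: powr_diff)
      finally show ?thesis .
    qed
    have "(\<Sum>i\<in>A. \<bar>v i\<bar> powr s') = (\<Sum>i\<in>A. \<bar>u i\<bar> powr s) / ?N powr s"
      by (simp add: abs_v sum_divide_distrib)
    also have "\<dots> = 1" using N by (simp flip: NN)
    finally show "sum_norm s' A v \<le> 1" by (simp add: sum_norm_def)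
  qed (simp add: v_def)
qed

text \<open>
  The norm of the sum is attained by pairing with one dual vector, and that pairing is additive.
\<close>

lemma Minkowski_sum:
  fixes u v :: "'i \<Rightarrow> real"
  assumes "finite A" and s: "1 < s"
  shows "sum_norm s A (\<lambda>i. u i + v i) \<le> sum_norm s A u + sum_norm s A v"
proof -
  define s' where "s' = s / (s - 1)"
  have s': "1 / s + 1 / s' = 1" using s by (simp add: s'_def field_simps)
  obtain w where w: "(\<Sum>i\<in>A. (u i + v i) * w i) = sum_norm s A (\<lambda>i. u i + v i)"
    "sum_norm s' A w \<le> 1"
    using sum_norm_dual_vector[OF assms(1) s s', of "\<lambda>i. u i + v i"] .
  have *: "(\<Sum>i\<in>A. f i * w i) \<le> sum_norm s A f" for f
  proof -
    have "(\<Sum>i\<in>A. f i * w i) \<le> (\<Sum>i\<in>A. \<bar>f i * w i\<bar>)" by (intro sum_mono) auto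
    also have "\<dots> \<le> sum_norm s A f * sum_norm s' A w" by (rule Holder_sum[OF assms s'])
    also have "\<dots> \<le> sum_norm s A f" using w(2) by (simp add: mult_left_le)
    finally show ?thesis .
  qed
  show ?thesis
  proof -
    have "sum_norm s A (\<lambda>i. u i + v i) = (\<Sum>i\<in>A. u i * w i) + (\<Sum>i\<in>A. v i * w i)"
      by (simp only: w(1)[symmetric] distrib_right sum.distrib)
    then show ?thesis using *[of u] *[of v] by linarith
  qed
qed

lemma lp_space_iff: "u \<in> lp_space s \<longleftrightarrow> (\<lambda>i. \<bar>u i\<bar> powr s) summable_on UNIV"
  by (simp only: lp_space_def mem_Collect_eq)

lemma sum_norm_le_lp_norm:
  assumes "0 < s" "u \<in> lp_space s" "finite A"
  shows "sum_norm s A u \<le> lp_norm s u"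
proof -
  have "(\<Sum>i\<in>A. \<bar>u i\<bar> powr s) \<le> (\<Sum>\<^sub>\<infinity>i. \<bar>u i\<bar> powr s)"
    using assms(2,3) by (intro finite_sum_le_infsum) (simp_all only: lp_space_iff subset_UNIV powr_ge_zero)
  then show ?thesis
    unfolding sum_norm_def lp_norm_def
    using assms(1) by (intro powr_mono2 sum_nonneg) simp_all
qed

lemma lp_norm_nonneg [simp]: "0 \<le> lp_norm s u"
  by (simp add: lp_norm_def)

text \<open>
  An infinite \<open>\<ell>\<^sup>s\<close> norm is the supremum of the norms over finite index sets. Through this
  criterion and its counterpart above, the inequalities for finite sums pass to infinite ones.
\<close>

lemma
  assumes s: "0 < s" and bound: "\<And>A. finite A \<Longrightarrow> sum_norm s A u \<le> B"
  shows lp_spaceI: "u \<in> lp_space s" and lp_norm_leI: "lp_norm s u \<le> B"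
proof -
  have B: "0 \<le> B" using bound[of "{}"] by (simp add: sum_norm_def)
  have fin: "(\<Sum>i\<in>A. \<bar>u i\<bar> powr s) \<le> B powr s" if "finite A" for A
    unfolding sum_norm_powr[OF s, symmetric]
    by (rule powr_mono2) (use bound[OF that] s in auto)
  show u: "u \<in> lp_space s"
    unfolding lp_space_iff
    by (rule nonneg_bdd_above_summable_on) (auto simp: bdd_above_def intro!: fin)
  have "(\<Sum>\<^sub>\<infinity>i. \<bar>u i\<bar> powr s) \<le> B powr s"
    using u fin unfolding lp_space_iff by (rule infsum_le_finite_sums)
  then have "lp_norm s u \<le> (B powr s) powr (1 / s)"
    unfolding lp_norm_def using s by (intro powr_mono2 infsum_nonneg) auto
  then show "lp_norm s u \<le> B" using s B by (simp add: powr_powr)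
qed

lemma
  assumes "1 < s" "u \<in> lp_space s" "v \<in> lp_space s"
  shows lp_space_add: "(\<lambda>i. u i + v i) \<in> lp_space s"
    and lp_norm_triangle: "lp_norm s (\<lambda>i. u i + v i) \<le> lp_norm s u + lp_norm s v"
proof -
  have *: "sum_norm s A (\<lambda>i. u i + v i) \<le> lp_norm s u + lp_norm s v" if "finite A" for A
    using Minkowski_sum[OF that assms(1), of u v] assms that
      sum_norm_le_lp_norm[of s u A] sum_norm_le_lp_norm[of s v A] by linarith
  show "(\<lambda>i. u i + v i) \<in> lp_space s"
    by (rule lp_spaceI[OF _ *]) (use assms in auto)
  show "lp_norm s (\<lambda>i. u i + v i) \<le> lp_norm s u + lp_norm s v"
    by (rule lp_norm_leI[OF _ *]) (use assms in auto)
qed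

lemma
  assumes "0 < s" "v \<in> lp_space s" "\<And>i. \<bar>u i\<bar> \<le> \<bar>v i\<bar>"
  shows lp_space_mono: "u \<in> lp_space s" and lp_norm_mono: "lp_norm s u \<le> lp_norm s v"
proof -
  have *: "sum_norm s A u \<le> lp_norm s v" if "finite A" for A
    using sum_norm_mono[of s A u v] sum_norm_le_lp_norm[of s v A] assms that by force
  show "u \<in> lp_space s" by (rule lp_spaceI[OF assms(1) *])
  show "lp_norm s u \<le> lp_norm s v" by (rule lp_norm_leI[OF assms(1) *])
qed

lemma
  assumes "0 < s" "u \<in> lp_space s"
  shows lp_space_scale: "(\<lambda>i. c * u i) \<in> lp_space s"
    and lp_norm_scale: "lp_norm s (\<lambda>i. c * u i) = \<bar>c\<bar> * lp_norm s u"
proof -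
  have eq: "\<bar>c * u i\<bar> powr s = \<bar>c\<bar> powr s * \<bar>u i\<bar> powr s" for i
    by (simp add: abs_mult powr_mult)
  show "(\<lambda>i. c * u i) \<in> lp_space s"
    using assms unfolding lp_space_iff eq by (intro summable_on_cmult_right)
  show "lp_norm s (\<lambda>i. c * u i) = \<bar>c\<bar> * lp_norm s u"
    using assms unfolding lp_norm_def eq
    by (simp add: infsum_cmult_right' powr_mult infsum_nonneg powr_powr)
qed

lemma lp_norm_abs [simp]: "lp_norm s (\<lambda>i. \<bar>u i\<bar>) = lp_norm s u"
  by (simp add: lp_norm_def)

lemma lp_space_abs [simp]: "(\<lambda>i. \<bar>u i\<bar>) \<in> lp_space s \<longleftrightarrow> u \<in> lp_space s"
  by (simp add: lp_space_iff)

lemma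
  assumes "finite A" "\<And>i. i \<notin> A \<Longrightarrow> u i = 0"
  shows lp_space_finite_support: "u \<in> lp_space s"
    and lp_norm_finite_support: "lp_norm s u = sum_norm s A u"
proof -
  have *: "((\<lambda>i. \<bar>u i\<bar> powr s) has_sum (\<Sum>i\<in>A. \<bar>u i\<bar> powr s)) UNIV"
    using assms by (intro has_sum_finite_neutralI[of A]) auto
  then show "u \<in> lp_space s" unfolding lp_space_iff summable_on_def by blast
  show "lp_norm s u = sum_norm s A u"
    using * by (simp add: lp_norm_def sum_norm_def infsumI)
qed

lemma lp_norm_eq_0D:
  assumes "0 < s" "u \<in> lp_space s" "lp_norm s u = 0"
  shows "u i = 0"
  using sum_norm_le_lp_norm[of s u "{i}"] assms sum_norm_eq_0D[of "{i}" s u i]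
  by (simp add: order_antisym)

lemma Holder_lp:
  assumes "1 < s" "1 / s + 1 / s' = 1" "u \<in> lp_space s" "v \<in> lp_space s'" "finite A"
  shows "(\<Sum>i\<in>A. \<bar>u i * v i\<bar>) \<le> lp_norm s u * lp_norm s' v"
proof -
  have "1 < s'" using conjugate_exponent_gt_1 assms by blast
  then show ?thesis
    using Holder_sum[OF assms(5,1,2), of u v] assms
      mult_mono[OF sum_norm_le_lp_norm[of s u A] sum_norm_le_lp_norm[of s' v A]]
    by force
qed

text \<open>
  Finite exponents make the tails small; this is the source of the density of finite sums
  in the block space.
\<close>

lemma lp_norm_tail_small:
  assumes "0 < s" "u \<in> lp_space s" "0 < e"
  obtains S where "finite S" "lp_norm s (\<lambda>i. if i \<in> S then 0 else u i) < e"
proof -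
  let ?f = "\<lambda>i. \<bar>u i\<bar> powr s"
  have sm: "?f summable_on UNIV" using assms by (simp add: lp_space_iff)
  have "0 < (e / 2) powr s" using assms by simp
  from infsum_finite_approximation[OF sm this] obtain S
    where S: "finite S" "dist (sum ?f S) (infsum ?f UNIV) \<le> (e / 2) powr s" by blast
  let ?t = "\<lambda>i. if i \<in> S then 0 else u i"
  have "((\<lambda>i. if i \<in> S then - ?f i else 0) has_sum (- sum ?f S)) UNIV"
    using S(1) by (intro has_sum_finite_neutralI[of S]) (auto simp: sum_negf)
  with sm have "((\<lambda>i. ?f i + (if i \<in> S then - ?f i else 0)) has_sum (infsum ?f UNIV + - sum ?f S)) UNIV"
    by (intro has_sum_add has_sum_infsum)
  also have "(\<lambda>i. ?f i + (if i \<in> S then - ?f i else 0)) = (\<lambda>i. \<bar>?t i\<bar> powr s)"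
    by auto
  finally have "lp_norm s ?t = (infsum ?f UNIV - sum ?f S) powr (1 / s)"
    by (simp add: lp_norm_def infsumI)
  also have "\<dots> \<le> ((e / 2) powr s) powr (1 / s)"
    using S assms finite_sum_le_infsum[OF sm S(1)]
    by (intro powr_mono2) (auto simp: dist_real_def)
  also have "\<dots> = e / 2" using assms by (simp add: powr_powr)
  finally show ?thesis using S(1) assms(3) by (intro that[of S]) auto
qed

section \<open>Normed spaces of functions and their functionals\<close>

lemma
  assumes "fun_normed_space V N" "x \<in> V"
  shows fun_normed_space_add: "y \<in> V \<Longrightarrow> (\<lambda>t. x t + y t) \<in> V"
    and fun_normed_space_scale: "(\<lambda>t. c * x t) \<in> V"
    and fun_normed_space_norm_scale: "N (\<lambda>t. c * x t) = \<bar>c\<bar> * N x"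
    and fun_normed_space_norm_nonneg: "0 \<le> N x"
  using assms by (simp_all add: fun_normed_space_def)

lemma
  assumes "bounded_functional_on V N F" "x \<in> V"
  shows bounded_functional_add: "y \<in> V \<Longrightarrow> F (\<lambda>t. x t + y t) = F x + F y"
    and bounded_functional_scale: "F (\<lambda>t. c * x t) = c * F x"
  using assms by (simp_all add: bounded_functional_on_def)

lemma bounded_functional_sum:
  assumes V: "fun_normed_space V N" and F: "bounded_functional_on V N F"
    and "finite A" "\<And>i. i \<in> A \<Longrightarrow> g i \<in> V"
  shows "(\<lambda>t. \<Sum>i\<in>A. c i * g i t) \<in> V \<and> F (\<lambda>t. \<Sum>i\<in>A. c i * g i t) = (\<Sum>i\<in>A. c i * F (g i))"
  using assms(3,4)
proof (induction A rule: finite_induct)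
  case empty
  have 0: "(\<lambda>_. 0) \<in> V" using V by (simp add: fun_normed_space_def)
  from bounded_functional_scale[OF F this, of 0] 0 show ?case by simp
next
  case (insert i A)
  let ?s = "\<lambda>t. \<Sum>i\<in>A. c i * g i t"
  have gi: "g i \<in> V" using insert.prems by simp
  have s: "?s \<in> V" "F ?s = (\<Sum>i\<in>A. c i * F (g i))"
    using insert.IH insert.prems by simp_all
  have ci: "(\<lambda>t. c i * g i t) \<in> V" "F (\<lambda>t. c i * g i t) = c i * F (g i)"
    by (rule fun_normed_space_scale[OF V gi], rule bounded_functional_scale[OF F gi])
  have "(\<lambda>t. c i * g i t + ?s t) \<in> V"
    by (rule fun_normed_space_add[OF V ci(1) s(1)])
  moreover have "F (\<lambda>t. c i * g i t + ?s t) = F (\<lambda>t. c i * g i t) + F ?s"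
    by (rule bounded_functional_add[OF F ci(1) s(1)])
  ultimately show ?case
    using insert.hyps by (simp add: ci(2) s(2))
qed

text \<open>
  The dual norm is a supremum over the unit ball; boundedness of the functional makes this
  supremum finite, and scaling carries the estimate to all vectors.
\<close>

lemma dual_norm_bound:
  assumes V: "fun_normed_space V N" and F: "bounded_functional_on V N F" and y: "y \<in> V"
  shows "\<bar>F y\<bar> \<le> dual_norm V N F * N y"
proof -
  obtain C where C: "\<And>x. x \<in> V \<Longrightarrow> \<bar>F x\<bar> \<le> C * N x"
    using F unfolding bounded_functional_on_def by blast
  note N = fun_normed_space_norm_nonneg[OF V]
  have bdd: "bdd_above ((\<lambda>x. \<bar>F x\<bar>) ` {x \<in> V. N x \<le> 1})"
  proof (rule bdd_aboveI2)
    fix x assume "x \<in> {x \<in> V. N x \<le> 1}"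
    then have x: "x \<in> V" "N x \<le> 1" by simp_all
    have "C * N x \<le> \<bar>C\<bar> * N x" using N[OF x(1)] by (simp add: mult_right_mono)
    also have "\<dots> \<le> \<bar>C\<bar>" using x by (simp add: mult_left_le)
    finally show "\<bar>F x\<bar> \<le> \<bar>C\<bar>" using C[OF x(1)] by linarith
  qed
  show ?thesis
  proof (cases "N y = 0")
    case True
    then show ?thesis using C[OF y] by simp
  next
    case False
    then have pos: "0 < N y" using N[OF y] by simp
    let ?z = "\<lambda>t. (1 / N y) * y t"
    have z: "?z \<in> V" "N ?z = \<bar>1 / N y\<bar> * N y"
      by (rule fun_normed_space_scale[OF V y], rule fun_normed_space_norm_scale[OF V y])
    have Fz: "F ?z = (1 / N y) * F y"
      by (rule bounded_functional_scale[OF F y])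
    have "?z \<in> {x \<in> V. N x \<le> 1}" using z pos by simp
    from cSUP_upper[OF this bdd] have "\<bar>F ?z\<bar> \<le> dual_norm V N F"
      unfolding dual_norm_def .
    then have "\<bar>F y\<bar> / N y \<le> dual_norm V N F" using pos unfolding Fz by (simp add: abs_mult)
    then show ?thesis using pos by (simp add: pos_divide_le_eq)
  qed
qed

text \<open>
  A linear isometry transports the norm axioms to its image. This yields the norm axioms on the
  dual of the block space once that dual is known to be an isometric image.
\<close>

lemma fun_normed_space_image:
  assumes V: "fun_normed_space V N" and T: "fun_linear_on V T"
    and iso: "\<And>x. x \<in> V \<Longrightarrow> M (T x) = N x"
  shows "fun_normed_space (T ` V) M"
proof -
  have zero: "(\<lambda>_. 0) \<in> V"
    and add: "\<And>x y. x \<in> V \<Longrightarrow> y \<in> V \<Longrightarrow> (\<lambda>t. x t + y t) \<in> V \<and> N (\<lambda>t. x t + y t) \<le> N x + N y"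
    and scale: "\<And>c x. x \<in> V \<Longrightarrow> (\<lambda>t. c * x t) \<in> V \<and> N (\<lambda>t. c * x t) = \<bar>c\<bar> * N x"
    and norm: "\<And>x. x \<in> V \<Longrightarrow> 0 \<le> N x \<and> (N x = 0 \<longleftrightarrow> x = (\<lambda>_. 0))"
    using V unfolding fun_normed_space_def by blast+
  have T_add: "\<And>x y. x \<in> V \<Longrightarrow> y \<in> V \<Longrightarrow> (\<lambda>s. T x s + T y s) = T (\<lambda>t. x t + y t)"
    and T_scale: "\<And>c x. x \<in> V \<Longrightarrow> (\<lambda>s. c * T x s) = T (\<lambda>t. c * x t)"
    using T unfolding fun_linear_on_def by simp_all
  have T_zero: "T (\<lambda>_. 0) = (\<lambda>_. 0)"
    using T_scale[OF zero, of 0] by simp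
  show ?thesis
    unfolding fun_normed_space_def
  proof (intro conjI ballI allI)
    show "(\<lambda>_. 0) \<in> T ` V" using imageI[OF zero, of T] T_zero by simp
    fix f assume "f \<in> T ` V"
    then obtain x where x: "x \<in> V" "f = T x" by blast
    show "0 \<le> M f" using norm x iso by simp
    show "M f = 0 \<longleftrightarrow> f = (\<lambda>_. 0)"
    proof
      assume "M f = 0"
      then have "x = (\<lambda>_. 0)" using norm x iso by simp
      then show "f = (\<lambda>_. 0)" using T_zero x by simp
    next
      assume "f = (\<lambda>_. 0)"
      then have "M f = N (\<lambda>_. 0)" using iso[OF zero] T_zero by simp
      then show "M f = 0" using norm[OF zero] by simp
    qed
    fix c
    show "(\<lambda>t. c * f t) \<in> T ` V" "M (\<lambda>t. c * f t) = \<bar>c\<bar> * M f"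
      using x iso scale[OF x(1)] T_scale[OF x(1)] by simp_all
  next
    fix f g assume "f \<in> T ` V" "g \<in> T ` V"
    then obtain x y where xy: "x \<in> V" "f = T x" "y \<in> V" "g = T y" by blast
    show "(\<lambda>t. f t + g t) \<in> T ` V" "M (\<lambda>t. f t + g t) \<le> M f + M g"
      using xy iso add[OF xy(1,3)] T_add[OF xy(1,3)] by simp_all
  qed
qed

section \<open>Dyadic intervals\<close>

lemma finite_dyadic [simp]: "finite (dyadic j k)"
  by (simp add: dyadic_def)

lemma card_dyadic: "card (dyadic j k) = 2 ^ j"
  by (simp add: dyadic_def algebra_simps nat_power_eq)

lemma mem_dyadic_iff: "m \<in> dyadic j k \<longleftrightarrow> k = m div 2 ^ j"
proof -
  have D: "0 < (2::int) ^ j" by simp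
  have m: "m = 2 ^ j * (m div 2 ^ j) + m mod 2 ^ j" by simp
  show ?thesis
  proof
    assume k: "k = m div 2 ^ j"
    have "0 \<le> m mod 2 ^ j" "m mod 2 ^ j < 2 ^ j" using D by simp_all
    then show "m \<in> dyadic j k"
      using m unfolding dyadic_def k atLeastLessThan_iff distrib_left mult_1_right by linarith
  next
    assume "m \<in> dyadic j k"
    then have "0 \<le> m - 2 ^ j * k" "m - 2 ^ j * k < 2 ^ j"
      by (simp_all add: dyadic_def distrib_left)
    then show "k = m div 2 ^ j"
      using int_div_pos_eq[of m "2 ^ j" k "m - 2 ^ j * k"] by simp
  qed
qed

definition point_mass :: "int \<Rightarrow> int \<Rightarrow> real" where
  "point_mass m n = (if n = m then 1 else 0)"

section \<open>Local norms and decompositions into pieces\<close>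

locale bourgain_morrey_exponents =
  fixes p q r p' q' r' :: real
  assumes p: "1 < p" and pq: "p < q" and r: "1 < r"
    and pp': "1 / p + 1 / p' = 1" and qq': "1 / q + 1 / q' = 1" and rr': "1 / r + 1 / r' = 1"
begin

text \<open>
  \<open>X\<close> and \<open>H\<close> are the two spaces put in duality, with \<open>H\<close> the block space.
\<close>

abbreviation "X \<equiv> bm_space p q r"
abbreviation "normX \<equiv> bm_norm p q r"
abbreviation "H \<equiv> block_space p' q' r'"
abbreviation "normH \<equiv> block_norm p' q' r'"

definition weight :: "nat \<Rightarrow> real" where
  "weight j = (2 ^ j) powr (1 / q - 1 / p)"

text \<open>
  The family whose \<open>\<ell>\<^sup>r\<close> norm is the norm of \<open>x\<close>; it is sublinear in \<open>x\<close>.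
\<close>

definition local_norm :: "(int \<Rightarrow> real) \<Rightarrow> nat \<times> int \<Rightarrow> real" where
  "local_norm x = (\<lambda>(j, k). weight j * sum_norm p (dyadic j k) x)"

lemma p': "1 < p'" and r': "1 < r'"
  using conjugate_exponent_gt_1 p pp' r rr' by blast+

lemma weight_pos [simp]: "0 < weight j" "0 \<le> weight j"
  by (simp_all add: weight_def)

lemma local_norm_nonneg [simp]: "0 \<le> local_norm x jk"
  by (simp add: local_norm_def split: prod.split)

lemma bm_term_eq: "bm_term p q r x jk = \<bar>local_norm x jk\<bar> powr r"
proof -
  obtain j k where jk: "jk = (j, k)" by (cases jk)
  have "\<bar>local_norm x jk\<bar> powr r = weight j powr r * sum_norm p (dyadic j k) x powr r"
    by (simp add: jk local_norm_def powr_mult)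
  then show ?thesis
    by (simp add: jk bm_term_def weight_def sum_norm_def powr_powr mult.commute)
qed

lemma bm_space_iff: "x \<in> X \<longleftrightarrow> local_norm x \<in> lp_space r"
  by (simp add: bm_space_def lp_space_iff bm_term_eq[abs_def])

lemma bm_norm_eq: "normX x = lp_norm r (local_norm x)"
  by (simp add: bm_norm_def lp_norm_def bm_term_eq)

lemma local_norm_add: "local_norm (\<lambda>m. x m + y m) jk \<le> local_norm x jk + local_norm y jk"
  using mult_left_mono[OF Minkowski_sum[OF finite_dyadic p], of "weight (fst jk)" "fst jk" "snd jk" x y]
  by (simp add: local_norm_def distrib_left case_prod_beta)

lemma local_norm_scale: "local_norm (\<lambda>m. c * x m) jk = \<bar>c\<bar> * local_norm x jk"
  using p by (simp add: local_norm_def sum_norm_scale split: prod.split)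

lemma fun_normed_space_bm: "fun_normed_space X normX"
  unfolding fun_normed_space_def
proof (intro conjI ballI allI)
  have "local_norm (\<lambda>_. 0) = (\<lambda>_. 0)" by (simp add: local_norm_def fun_eq_iff)
  then have 0: "(\<lambda>_. 0) \<in> X" "normX (\<lambda>_. 0) = 0"
    by (simp_all add: bm_space_iff bm_norm_eq lp_space_iff lp_norm_def)
  show "(\<lambda>_. 0) \<in> X" by fact
  fix x assume x: "x \<in> X"
  show "0 \<le> normX x" by (simp add: bm_norm_eq)
  show "normX x = 0 \<longleftrightarrow> x = (\<lambda>_. 0)"
  proof
    assume "normX x = 0"
    then have "local_norm x (0, m) = 0" for m
      using x r lp_norm_eq_0D[of r "local_norm x" "(0, m)"] by (simp add: bm_space_iff bm_norm_eq)
    then have "sum_norm p (dyadic 0 m) x = 0" for m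
      by (simp add: local_norm_def weight_def)
    moreover have "m \<in> dyadic 0 m" for m by (simp add: mem_dyadic_iff)
    ultimately have "x m = 0" for m
      using sum_norm_eq_0D[of "dyadic 0 m" p x m] p by simp
    then show "x = (\<lambda>_. 0)" by blast
  qed (simp add: 0)
  {
    fix y assume y: "y \<in> X"
    have le: "\<bar>local_norm (\<lambda>m. x m + y m) jk\<bar> \<le> \<bar>local_norm x jk + local_norm y jk\<bar>" for jk
      using local_norm_add[of x y jk] by (simp add: order_trans[OF _ abs_ge_self])
    have sum: "(\<lambda>jk. local_norm x jk + local_norm y jk) \<in> lp_space r"
      using x y r by (intro lp_space_add) (simp_all add: bm_space_iff)
    show "(\<lambda>m. x m + y m) \<in> X"
      unfolding bm_space_iff by (rule lp_space_mono[OF _ sum le]) (use r in simp)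
    show "normX (\<lambda>m. x m + y m) \<le> normX x + normX y"
      unfolding bm_norm_eq using r x y
      by (intro order_trans[OF lp_norm_mono[OF _ sum le] lp_norm_triangle])
        (simp_all add: bm_space_iff)
  }
  fix c
  show "(\<lambda>m. c * x m) \<in> X" "normX (\<lambda>m. c * x m) = \<bar>c\<bar> * normX x"
    using lp_space_scale[of r "local_norm x" "\<bar>c\<bar>"] lp_norm_scale[of r "local_norm x" "\<bar>c\<bar>"] x r
    by (simp_all add: bm_space_iff bm_norm_eq local_norm_scale[abs_def])
qed

lemma is_block_iff:
  "is_block q' p' (dyadic j k) a \<longleftrightarrow>
     (\<forall>m. m \<notin> dyadic j k \<longrightarrow> a m = 0) \<and> sum_norm p' (dyadic j k) a \<le> weight j"
proof -
  have "1 / p' - 1 / q' = 1 / q - 1 / p" using pp' qq' by linarith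
  then have "real (card (dyadic j k)) powr (1 / p' - 1 / q') = weight j"
    by (simp add: card_dyadic weight_def)
  moreover have "{m. a m \<noteq> 0} \<subseteq> dyadic j k \<longleftrightarrow> (\<forall>m. m \<notin> dyadic j k \<longrightarrow> a m = 0)"
    by blast
  moreover have "lp_norm p' a = sum_norm p' (dyadic j k) a" if "\<forall>m. m \<notin> dyadic j k \<longrightarrow> a m = 0"
    using that by (intro lp_norm_finite_support) simp_all
  ultimately show ?thesis unfolding is_block_def by (simp cong: conj_cong)
qed

text \<open>
  Convergence in \<open>\<ell>\<^sup>1\<close> on finite sets is pointwise convergence of the net of partial sums, that
  is, unordered summation at each point.
\<close>

lemma block_rep_iff:
  "block_rep p' q' r' c a y \<longleftrightarrow>
     c \<in> lp_space r' \<and> (\<forall>j k. is_block q' p' (dyadic j k) (a (j, k))) \<and>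
     (\<forall>m. ((\<lambda>jk. c jk * a jk m) has_sum y m) UNIV)"
proof -
  let ?T = "\<lambda>M S. \<Sum>m\<in>M. \<bar>(\<Sum>jk\<in>S. c jk * a jk m) - y m\<bar>"
  have pt: "((\<lambda>jk. c jk * a jk m) has_sum y m) UNIV
      \<longleftrightarrow> (?T {m} \<longlongrightarrow> 0) (finite_subsets_at_top UNIV)" for m
    by (simp add: has_sum_def tendsto_rabs_zero_iff LIM_zero_iff)
  have iff: "(\<forall>M. finite M \<longrightarrow> (?T M \<longlongrightarrow> 0) (finite_subsets_at_top UNIV))
      \<longleftrightarrow> (\<forall>m. (?T {m} \<longlongrightarrow> 0) (finite_subsets_at_top UNIV))" (is "?L = ?R")
  proof
    assume R: ?R
    show ?L
    proof (intro allI impI tendsto_null_sum)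
      fix M m
      show "((\<lambda>S. \<bar>(\<Sum>jk\<in>S. c jk * a jk m) - y m\<bar>) \<longlongrightarrow> 0) (finite_subsets_at_top UNIV)"
        using R[rule_format, of m] by simp
    qed
  next
    assume L: ?L
    show ?R by (intro allI L[rule_format]) simp
  qed
  show ?thesis by (simp only: block_rep_def pt iff)
qed

text \<open>
  Block representations with the coefficients absorbed into the blocks: \<open>g I\<close> replaces \<open>c I\<close> times
  a block, and \<open>d I\<close> is any admissible bound for its size. Unlike blocks with coefficients,
  these data can be added and scaled termwise, which gives the vector space structure and the
  triangle inequality.
\<close>

definition decomposition :: "(nat \<times> int \<Rightarrow> real) \<Rightarrow> (nat \<times> int \<Rightarrow> int \<Rightarrow> real) \<Rightarrow> (int \<Rightarrow> real) \<Rightarrow> bool"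
  where
  "decomposition d g y \<longleftrightarrow>
     d \<in> lp_space r' \<and> (\<forall>jk. 0 \<le> d jk) \<and>
     (\<forall>j k m. m \<notin> dyadic j k \<longrightarrow> g (j, k) m = 0) \<and>
     (\<forall>j k. sum_norm p' (dyadic j k) (g (j, k)) \<le> d (j, k) * weight j) \<and>
     (\<forall>m. ((\<lambda>jk. g jk m) has_sum y m) UNIV)"

lemma decomposition_of_rep:
  assumes "block_rep p' q' r' c a y"
  shows "decomposition (\<lambda>jk. \<bar>c jk\<bar>) (\<lambda>jk m. c jk * a jk m) y"
proof -
  have "sum_norm p' (dyadic j k) (\<lambda>m. c (j, k) * a (j, k) m) \<le> \<bar>c (j, k)\<bar> * weight j" for j k
    using assms p' unfolding block_rep_iff is_block_iff
    by (simp add: sum_norm_scale mult_left_mono)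
  then show ?thesis
    using assms unfolding decomposition_def block_rep_iff is_block_iff by simp
qed

text \<open>
  Dividing a piece by its bound gives a block. Where the bound is 0, the piece vanishes, and
  division by 0 yields the zero block.
\<close>

lemma block_rep_of_decomposition:
  assumes "decomposition d g y"
  shows "block_rep p' q' r' d (\<lambda>jk m. 1 / d jk * g jk m) y"
proof -
  note d = assms[unfolded decomposition_def]
  have scaled: "d (j, k) * (1 / d (j, k) * g (j, k) m) = g (j, k) m" for j k m
  proof (cases "d (j, k) = 0 \<and> m \<in> dyadic j k")
    case True
    then have "sum_norm p' (dyadic j k) (g (j, k)) = 0"
      using d sum_norm_nonneg[of p' "dyadic j k" "g (j, k)"]
      by (metis mult_zero_left order_antisym)
    then have "g (j, k) m = 0"
      using p' True[THEN conjunct2] sum_norm_eq_0D[of "dyadic j k" p' "g (j, k)" m] by simp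
    then show ?thesis by simp
  next
    case False
    then show ?thesis using d by (cases "d (j, k) = 0") simp_all
  qed
  have "sum_norm p' (dyadic j k) (\<lambda>m. 1 / d (j, k) * g (j, k) m) \<le> weight j" for j k
  proof (cases "d (j, k) = 0")
    case False
    moreover have "0 \<le> d (j, k)" using d by blast
    ultimately have "0 < d (j, k)" by simp
    moreover have "sum_norm p' (dyadic j k) (g (j, k)) \<le> d (j, k) * weight j" using d by blast
    ultimately show ?thesis
      using p' by (simp only: sum_norm_scale) (simp add: field_simps)
  qed simp
  moreover have "(\<lambda>jk. d jk * (1 / d jk * g jk m)) = (\<lambda>jk. g jk m)" for m
  proof
    show "d jk * (1 / d jk * g jk m) = g jk m" for jk
      using scaled[of "fst jk" "snd jk" m] by simp
  qed
  ultimately show ?thesis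
    using d unfolding block_rep_iff is_block_iff by simp
qed

lemma block_space_iff: "y \<in> H \<longleftrightarrow> (\<exists>d g. decomposition d g y)"
proof
  assume "y \<in> H"
  then obtain c a where "block_rep p' q' r' c a y" unfolding block_space_def mem_Collect_eq by (elim exE)
  then show "\<exists>d g. decomposition d g y" by (intro exI) (rule decomposition_of_rep)
next
  assume "\<exists>d g. decomposition d g y"
  then obtain d g where "decomposition d g y" by (elim exE)
  then show "y \<in> H"
    unfolding block_space_def mem_Collect_eq by (intro exI) (rule block_rep_of_decomposition)
qed

lemma block_norm_le:
  assumes "decomposition d g y"
  shows "normH y \<le> lp_norm r' d"
  unfolding block_norm_def
proof (rule cInf_lower)
  show "bdd_below {lp_norm r' c | c a. block_rep p' q' r' c a y}"
    by (rule bdd_belowI[of _ 0]) (elim CollectE exE conjE, simp)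
  show "lp_norm r' d \<in> {lp_norm r' c | c a. block_rep p' q' r' c a y}"
    unfolding mem_Collect_eq by (intro exI) (rule conjI[OF refl block_rep_of_decomposition[OF assms]])
qed

lemma block_norm_decomposition:
  assumes "y \<in> H" "0 < e"
  obtains d g where "decomposition d g y" "lp_norm r' d < normH y + e"
proof -
  have "{lp_norm r' c | c a. block_rep p' q' r' c a y} \<noteq> {}"
    using assms(1) by (simp add: block_space_def)
  moreover have "Inf {lp_norm r' c | c a. block_rep p' q' r' c a y} < normH y + e"
    using assms(2) by (simp add: block_norm_def)
  ultimately obtain b where "b \<in> {lp_norm r' c | c a. block_rep p' q' r' c a y}" "b < normH y + e"
    by (meson cInf_lessD)
  then obtain c a where "block_rep p' q' r' c a y" "lp_norm r' c < normH y + e"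
    by blast
  then show ?thesis
    using that[OF decomposition_of_rep] by simp
qed

lemma block_norm_nonneg:
  assumes "y \<in> H"
  shows "0 \<le> normH y"
  unfolding block_norm_def
proof (rule cInf_greatest)
  show "{lp_norm r' c | c a. block_rep p' q' r' c a y} \<noteq> {}"
    using assms by (simp add: block_space_def)
qed (elim CollectE exE conjE, simp)

section \<open>The pairing is bounded\<close>

text \<open>
  Hoelder's inequality bounds the pairing with the piece on \<open>I\<close> by \<open>d I\<close> times the local norm,
  and a second application bounds the sum over finitely many intervals. The estimate involves
  absolute values and a fixed finite set \<open>M\<close> of points, so it survives the pointwise limit.
\<close>

lemma pairing_decomposition:
  assumes x: "x \<in> X" and D: "decomposition d g y" and M: "finite M"
  shows "(\<Sum>m\<in>M. \<bar>x m * y m\<bar>) \<le> normX x * lp_norm r' d"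
proof -
  note D' = D[unfolded decomposition_def]
  have piece: "(\<Sum>m\<in>M. \<bar>x m * g jk m\<bar>) \<le> local_norm x jk * d jk" for jk
  proof -
    obtain j k where jk: "jk = (j, k)" by (cases jk)
    have zero: "g jk m = 0" if "m \<notin> dyadic j k" for m using D' that jk by blast
    have "(\<Sum>m\<in>M. \<bar>x m * g jk m\<bar>) = (\<Sum>m\<in>M \<inter> dyadic j k. \<bar>x m * g jk m\<bar>)"
      using M zero by (intro sum.mono_neutral_right) auto
    also have "\<dots> \<le> (\<Sum>m\<in>dyadic j k. \<bar>x m * g jk m\<bar>)"
      by (intro sum_mono2) auto
    also have "\<dots> \<le> sum_norm p (dyadic j k) x * sum_norm p' (dyadic j k) (g jk)"
      by (rule Holder_sum[OF finite_dyadic p pp'])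
    also have "\<dots> \<le> sum_norm p (dyadic j k) x * (d jk * weight j)"
      using D' unfolding jk by (intro mult_left_mono) simp_all
    finally show ?thesis by (simp add: jk local_norm_def mult_ac)
  qed
  have partial: "(\<Sum>m\<in>M. \<bar>x m * (\<Sum>jk\<in>S. g jk m)\<bar>) \<le> normX x * lp_norm r' d" if S: "finite S" for S
  proof -
    have "(\<Sum>m\<in>M. \<bar>x m * (\<Sum>jk\<in>S. g jk m)\<bar>) \<le> (\<Sum>m\<in>M. \<Sum>jk\<in>S. \<bar>x m * g jk m\<bar>)"
      unfolding sum_distrib_left by (intro sum_mono sum_abs)
    also have "\<dots> = (\<Sum>jk\<in>S. \<Sum>m\<in>M. \<bar>x m * g jk m\<bar>)" by (rule sum.swap)
    also have "\<dots> \<le> (\<Sum>jk\<in>S. \<bar>local_norm x jk * d jk\<bar>)"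
      by (intro sum_mono) (rule order_trans[OF piece abs_ge_self])
    also have "\<dots> \<le> normX x * lp_norm r' d"
      unfolding bm_norm_eq using x D' S
      by (intro Holder_lp[OF r rr']) (simp_all add: bm_space_iff)
    finally show ?thesis .
  qed
  have "((\<lambda>S. \<Sum>m\<in>M. \<bar>x m * (\<Sum>jk\<in>S. g jk m)\<bar>) \<longlongrightarrow> (\<Sum>m\<in>M. \<bar>x m * y m\<bar>))
      (finite_subsets_at_top UNIV)"
    using D' unfolding has_sum_def
    by (intro tendsto_sum tendsto_rabs tendsto_mult tendsto_const) simp
  then show ?thesis
    by (rule tendsto_upperbound)
      (simp_all add: partial eventually_finite_subsets_at_top_weakI)
qed

text \<open>
  Passage to the infimum over all decompositions; \<open>normX x + 1\<close> avoids dividing by 0.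
\<close>

lemma pairing_sum_le:
  assumes x: "x \<in> X" and y: "y \<in> H" and M: "finite M"
  shows "(\<Sum>m\<in>M. \<bar>x m * y m\<bar>) \<le> normX x * normH y"
proof (rule field_le_epsilon)
  fix e :: real assume e: "0 < e"
  have X: "0 \<le> normX x" by (simp add: bm_norm_eq)
  have pos: "0 < e / (normX x + 1)" using e X by simp
  obtain d g where D: "decomposition d g y" "lp_norm r' d < normH y + e / (normX x + 1)"
    using block_norm_decomposition[OF y pos] .
  have "(\<Sum>m\<in>M. \<bar>x m * y m\<bar>) \<le> normX x * lp_norm r' d"
    by (rule pairing_decomposition[OF x D(1) M])
  also have "\<dots> \<le> normX x * (normH y + e / (normX x + 1))"
    using D(2) X by (intro mult_left_mono) simp_all
  also have "\<dots> \<le> normX x * normH y + e"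
    using X e by (simp add: distrib_left field_simps)
  finally show "(\<Sum>m\<in>M. \<bar>x m * y m\<bar>) \<le> normX x * normH y + e" .
qed

lemma
  assumes x: "x \<in> X" and y: "y \<in> H"
  shows pairing_summable: "(\<lambda>m. x m * y m) summable_on UNIV"
    and pairing_le: "\<bar>\<Sum>\<^sub>\<infinity>m. x m * y m\<bar> \<le> normX x * normH y"
proof -
  have *: "(\<lambda>m. \<bar>x m * y m\<bar>) summable_on UNIV"
    using pairing_sum_le[OF x y]
    by (intro nonneg_bdd_above_summable_on bdd_aboveI2) simp_all
  then show "(\<lambda>m. x m * y m) summable_on UNIV"
    using abs_summable_summable[of "\<lambda>m. x m * y m" UNIV] by simp
  have "\<bar>\<Sum>\<^sub>\<infinity>m. x m * y m\<bar> \<le> (\<Sum>\<^sub>\<infinity>m. \<bar>x m * y m\<bar>)"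
    using norm_infsum_bound[of "\<lambda>m. x m * y m" UNIV] * by simp
  also have "\<dots> \<le> normX x * normH y"
    using * pairing_sum_le[OF x y] by (intro infsum_le_finite_sums) simp_all
  finally show "\<bar>\<Sum>\<^sub>\<infinity>m. x m * y m\<bar> \<le> normX x * normH y" .
qed

section \<open>Point masses and finite sums of blocks\<close>

text \<open>
  The weights form a geometric sequence in the scale \<open>j\<close>; its ratio is below 1 because
  \<open>p < q\<close>.
\<close>

lemma weight_summable: "(\<lambda>j. weight j powr r) summable_on UNIV"
proof -
  let ?b = "2 powr ((1 / q - 1 / p) * r)"
  have "(1 / q - 1 / p) * r < 0" using p pq r by (intro mult_neg_pos) (simp_all add: frac_less2)
  then have "?b < 1" using powr_less_mono[of _ 0 "2::real"] by simp
  moreover have "weight j powr r = ?b ^ j" for j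
    by (simp add: weight_def powr_powr powr_realpow[symmetric] mult_ac)
  ultimately show ?thesis
    by (intro summable_nonneg_imp_summable_on) (simp_all add: summable_geometric)
qed

text \<open>
  Only one interval per scale contains \<open>m\<close>, and there the local norm is the weight, so the norm
  of a point mass is a geometric series.
\<close>

lemma point_mass_in_bm_space: "point_mass m \<in> X"
proof -
  let ?h = "\<lambda>j::nat. (j, m div 2 ^ j)"
  let ?f = "\<lambda>jk. \<bar>local_norm (point_mass m) jk\<bar> powr r"
  have f: "?f (j, k) = (if k = m div 2 ^ j then weight j powr r else 0)" for j k
  proof (cases "k = m div 2 ^ j")
    case True
    have "(\<Sum>l\<in>dyadic j k. \<bar>point_mass m l\<bar> powr p) = (\<Sum>l\<in>dyadic j k. if l = m then 1 else 0)"
      by (intro sum.cong) (simp_all add: point_mass_def)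
    also have "\<dots> = 1" using True by (simp add: mem_dyadic_iff)
    finally show ?thesis using True by (simp add: local_norm_def sum_norm_def)
  next
    case False
    then have "(\<Sum>l\<in>dyadic j k. \<bar>point_mass m l\<bar> powr p) = 0"
      by (intro sum.neutral) (auto simp add: point_mass_def mem_dyadic_iff)
    then show ?thesis using False by (simp add: local_norm_def sum_norm_def)
  qed
  have inj: "inj ?h" by (rule injI) simp
  have "?f \<circ> ?h = (\<lambda>j. weight j powr r)" by (simp only: comp_def f simp_thms if_True)
  then have "?f summable_on range ?h"
    using weight_summable by (simp only: summable_on_reindex[OF inj])
  also have "?f summable_on range ?h \<longleftrightarrow> ?f summable_on UNIV"
  proof (rule summable_on_cong_neutral)
    fix jk assume jk: "jk \<in> UNIV - range ?h"
    obtain j k where "jk = (j, k)" by (cases jk)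
    then show "?f jk = 0" using jk f[of j k] by auto
  qed simp_all
  finally show ?thesis by (simp only: bm_space_iff lp_space_iff)
qed

lemma
  assumes S: "finite S" and b: "\<And>j k. (j, k) \<in> S \<Longrightarrow> is_block q' p' (dyadic j k) (b (j, k))"
  shows finite_block_sum_in_block_space: "(\<lambda>m. \<Sum>jk\<in>S. c jk * b jk m) \<in> H"
    and finite_block_sum_norm_le: "normH (\<lambda>m. \<Sum>jk\<in>S. c jk * b jk m) \<le> sum_norm r' S c"
proof -
  let ?d = "\<lambda>jk. if jk \<in> S then \<bar>c jk\<bar> else 0"
  let ?g = "\<lambda>jk m. if jk \<in> S then c jk * b jk m else 0"
  have d: "?d \<in> lp_space r'" "lp_norm r' ?d = sum_norm r' S ?d"
    using lp_space_finite_support[OF S, of ?d] lp_norm_finite_support[OF S, of ?d] by simp_all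
  have dec: "decomposition ?d ?g (\<lambda>m. \<Sum>jk\<in>S. c jk * b jk m)"
    unfolding decomposition_def
  proof (intro conjI allI impI d)
    fix j k m assume "m \<notin> dyadic j k"
    then show "?g (j, k) m = 0" using b by (simp add: is_block_iff)
  next
    fix j k
    show "sum_norm p' (dyadic j k) (?g (j, k)) \<le> ?d (j, k) * weight j"
      using b[of j k] p' by (simp add: is_block_iff sum_norm_scale mult_left_mono)
  next
    fix m
    show "((\<lambda>jk. ?g jk m) has_sum (\<Sum>jk\<in>S. c jk * b jk m)) UNIV"
      using S by (intro has_sum_finite_neutralI[of S]) simp_all
  qed simp
  then show "(\<lambda>m. \<Sum>jk\<in>S. c jk * b jk m) \<in> H"
    unfolding block_space_iff by (intro exI)
  have "sum_norm r' S ?d = sum_norm r' S c" by (rule sum_norm_cong) simp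
  then show "normH (\<lambda>m. \<Sum>jk\<in>S. c jk * b jk m) \<le> sum_norm r' S c"
    using block_norm_le[OF dec] d(2) by simp
qed

lemma point_mass_is_block: "is_block q' p' (dyadic 0 m) (point_mass m)"
proof -
  have "dyadic 0 m = {m}" by (auto simp: dyadic_def)
  then show ?thesis unfolding is_block_iff by (simp add: point_mass_def sum_norm_def weight_def)
qed

lemma point_mass_in_block_space: "point_mass m \<in> H"
  using finite_block_sum_in_block_space[of "{(0, m)}" "\<lambda>_. point_mass m" "\<lambda>_. 1"] point_mass_is_block
  by simp

section \<open>The block norm is a norm\<close>

lemma decomposition_add:
  assumes "decomposition d g y" "decomposition d' g' y'"
  shows "decomposition (\<lambda>jk. d jk + d' jk) (\<lambda>jk m. g jk m + g' jk m) (\<lambda>m. y m + y' m)"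
  unfolding decomposition_def
proof (intro conjI allI impI)
  note D = assms[unfolded decomposition_def]
  show "(\<lambda>jk. d jk + d' jk) \<in> lp_space r'" using D r' by (intro lp_space_add) simp_all
  fix j k m
  show "g (j, k) m + g' (j, k) m = 0" if "m \<notin> dyadic j k" using D that by simp
  have "sum_norm p' (dyadic j k) (\<lambda>m. g (j, k) m + g' (j, k) m)
      \<le> sum_norm p' (dyadic j k) (g (j, k)) + sum_norm p' (dyadic j k) (g' (j, k))"
    by (rule Minkowski_sum[OF finite_dyadic p'])
  also have "\<dots> \<le> d (j, k) * weight j + d' (j, k) * weight j"
    using D by (intro add_mono) simp_all
  finally show "sum_norm p' (dyadic j k) (\<lambda>m. g (j, k) m + g' (j, k) m) \<le> (d (j, k) + d' (j, k)) * weight j"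
    by (simp add: distrib_right)
  show "((\<lambda>jk. g jk m + g' jk m) has_sum (y m + y' m)) UNIV"
    using D by (intro has_sum_add) simp_all
  show "0 \<le> d jk + d' jk" for jk
    using D by (intro add_nonneg_nonneg) blast+
qed

lemma decomposition_scale:
  assumes "decomposition d g y"
  shows "decomposition (\<lambda>jk. \<bar>c\<bar> * d jk) (\<lambda>jk m. c * g jk m) (\<lambda>m. c * y m)"
  unfolding decomposition_def
proof (intro conjI allI impI)
  note D = assms[unfolded decomposition_def]
  show "(\<lambda>jk. \<bar>c\<bar> * d jk) \<in> lp_space r'" using D r' by (intro lp_space_scale) simp_all
  show "0 \<le> \<bar>c\<bar> * d jk" for jk using D by (intro mult_nonneg_nonneg abs_ge_zero) blast
  fix j k m
  show "c * g (j, k) m = 0" if "m \<notin> dyadic j k" using D that by simp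
  show "sum_norm p' (dyadic j k) (\<lambda>m. c * g (j, k) m) \<le> \<bar>c\<bar> * d (j, k) * weight j"
    using D p' by (simp add: sum_norm_scale mult.assoc mult_left_mono)
  show "((\<lambda>jk. c * g jk m) has_sum (c * y m)) UNIV" using D by (intro has_sum_cmult_right) blast
qed

lemma block_norm_triangle:
  assumes "y \<in> H" "z \<in> H"
  shows "(\<lambda>m. y m + z m) \<in> H" "normH (\<lambda>m. y m + z m) \<le> normH y + normH z"
proof -
  obtain d g d' g' where "decomposition d g y" "decomposition d' g' z"
    using assms unfolding block_space_iff by (elim exE)
  from decomposition_add[OF this] show "(\<lambda>m. y m + z m) \<in> H"
    unfolding block_space_iff by (intro exI)
  show "normH (\<lambda>m. y m + z m) \<le> normH y + normH z"
  proof (rule field_le_epsilon)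
    fix e :: real assume "0 < e"
    then have e: "0 < e / 2" by simp
    obtain d g where D: "decomposition d g y" "lp_norm r' d < normH y + e / 2"
      using block_norm_decomposition[OF assms(1) e] .
    obtain d' g' where D': "decomposition d' g' z" "lp_norm r' d' < normH z + e / 2"
      using block_norm_decomposition[OF assms(2) e] .
    have "normH (\<lambda>m. y m + z m) \<le> lp_norm r' (\<lambda>jk. d jk + d' jk)"
      by (rule block_norm_le[OF decomposition_add[OF D(1) D'(1)]])
    also have "\<dots> \<le> lp_norm r' d + lp_norm r' d'"
      using D(1) D'(1) unfolding decomposition_def by (intro lp_norm_triangle[OF r']) simp_all
    finally show "normH (\<lambda>m. y m + z m) \<le> normH y + normH z + e" using D(2) D'(2) by simp
  qed
qed

lemma block_norm_scale_le:
  assumes "y \<in> H"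
  shows "(\<lambda>m. c * y m) \<in> H" "normH (\<lambda>m. c * y m) \<le> \<bar>c\<bar> * normH y"
proof -
  obtain d g where "decomposition d g y"
    using assms unfolding block_space_iff by (elim exE)
  from decomposition_scale[OF this] show "(\<lambda>m. c * y m) \<in> H"
    unfolding block_space_iff by (intro exI)
  show "normH (\<lambda>m. c * y m) \<le> \<bar>c\<bar> * normH y"
  proof (rule field_le_epsilon)
    fix e :: real assume e: "0 < e"
    then have pos: "0 < e / (\<bar>c\<bar> + 1)" by simp
    obtain d g where D: "decomposition d g y" "lp_norm r' d < normH y + e / (\<bar>c\<bar> + 1)"
      using block_norm_decomposition[OF assms pos] .
    have "normH (\<lambda>m. c * y m) \<le> lp_norm r' (\<lambda>jk. \<bar>c\<bar> * d jk)"
      by (rule block_norm_le[OF decomposition_scale[OF D(1)]])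
    also have "\<dots> = \<bar>c\<bar> * lp_norm r' d"
      using D(1) r' unfolding decomposition_def by (simp add: lp_norm_scale)
    also have "\<dots> \<le> \<bar>c\<bar> * (normH y + e / (\<bar>c\<bar> + 1))"
      using D(2) by (intro mult_left_mono) simp_all
    also have "\<dots> \<le> \<bar>c\<bar> * normH y + e"
      using e by (simp add: distrib_left field_simps)
    finally show "normH (\<lambda>m. c * y m) \<le> \<bar>c\<bar> * normH y + e" .
  qed
qed

text \<open>
  Definiteness comes from duality: pairing with the point mass at \<open>m\<close>, which has finite norm in
  \<open>X\<close>, bounds \<open>\<bar>y m\<bar>\<close> by a multiple of the block norm of \<open>y\<close>.
\<close>

lemma fun_normed_space_block: "fun_normed_space H normH"
  unfolding fun_normed_space_def
proof (intro conjI ballI allI)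
  have zero: "(\<lambda>_. 0) \<in> H" using block_norm_scale_le(1)[OF point_mass_in_block_space, of 0] by simp
  then show "(\<lambda>_. 0) \<in> H" .
  fix y assume y: "y \<in> H"
  show "0 \<le> normH y" by (rule block_norm_nonneg[OF y])
  show "normH y = 0 \<longleftrightarrow> y = (\<lambda>_. 0)"
  proof
    assume 0: "normH y = 0"
    have "y m = 0" for m
      using pairing_sum_le[OF point_mass_in_bm_space y, of "{m}" m] 0 by (simp add: point_mass_def)
    then show "y = (\<lambda>_. 0)" by blast
  next
    assume "y = (\<lambda>_. 0)"
    then have "normH y \<le> 0" using block_norm_scale_le(2)[OF y, of 0] by simp
    then show "normH y = 0" using block_norm_nonneg[OF y] by simp
  qed
  show "(\<lambda>m. y m + z m) \<in> H" "normH (\<lambda>m. y m + z m) \<le> normH y + normH z" if "z \<in> H" for z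
    using block_norm_triangle[OF y that] .
  fix c
  show cy: "(\<lambda>m. c * y m) \<in> H" by (rule block_norm_scale_le[OF y])
  show "normH (\<lambda>m. c * y m) = \<bar>c\<bar> * normH y"
  proof (rule antisym)
    show "\<bar>c\<bar> * normH y \<le> normH (\<lambda>m. c * y m)"
    proof (cases "c = 0")
      case True
      then show ?thesis using block_norm_nonneg[OF cy] by simp
    next
      case False
      then show ?thesis
        using block_norm_scale_le(2)[OF cy, of "1 / c"] by (simp add: field_simps)
    qed
  qed (rule block_norm_scale_le[OF y])
qed

section \<open>Bounded functionals on the block space\<close>

lemma functional_finite_support:
  assumes F: "bounded_functional_on H normH F" and M: "finite M" "\<And>m. m \<notin> M \<Longrightarrow> y m = 0"
  shows "F y = (\<Sum>m\<in>M. y m * F (point_mass m))"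
proof -
  have "y n = (\<Sum>m\<in>M. y m * point_mass m n)" for n
  proof -
    have "(\<Sum>m\<in>M. y m * point_mass m n) = (\<Sum>m\<in>M. if m = n then y m else 0)"
      by (intro sum.cong) (auto simp: point_mass_def)
    then show ?thesis using M by (simp add: sum.delta')
  qed
  then have y: "y = (\<lambda>n. \<Sum>m\<in>M. y m * point_mass m n)" by (rule ext)
  show ?thesis
    by (subst y)
      (rule bounded_functional_sum[OF fun_normed_space_block F M(1) point_mass_in_block_space, THEN conjunct2])
qed

text \<open>
  The decisive estimate. The test element is a combination of blocks \<open>b\<close> that are extremal for
  \<open>x\<close> on each interval, with coefficients \<open>c\<close> that are extremal for the local norms; its block
  norm is at most 1 and \<open>F\<close> maps it to the \<open>\<ell>\<^sup>r\<close> norm of the local norms over \<open>S\<close>.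
\<close>

lemma functional_coefficients:
  assumes F: "bounded_functional_on H normH F" and C: "0 \<le> C" "\<And>y. y \<in> H \<Longrightarrow> \<bar>F y\<bar> \<le> C * normH y"
  shows "(\<lambda>m. F (point_mass m)) \<in> X" "normX (\<lambda>m. F (point_mass m)) \<le> C"
proof -
  define x where "x m = F (point_mass m)" for m
  have *: "sum_norm r S (local_norm x) \<le> C" if S: "finite S" for S
  proof -
    have "\<forall>j k. \<exists>v. (\<forall>m. m \<notin> dyadic j k \<longrightarrow> v m = 0) \<and>
        (\<Sum>m\<in>dyadic j k. x m * v m) = sum_norm p (dyadic j k) x \<and> sum_norm p' (dyadic j k) v \<le> 1"
    proof (intro allI)
      fix j k
      show "\<exists>v. (\<forall>m. m \<notin> dyadic j k \<longrightarrow> v m = 0) \<and>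
          (\<Sum>m\<in>dyadic j k. x m * v m) = sum_norm p (dyadic j k) x \<and> sum_norm p' (dyadic j k) v \<le> 1"
      proof (rule sum_norm_dual_vector[OF finite_dyadic p pp', of j k x])
        fix v :: "int \<Rightarrow> real"
        assume "\<And>m. m \<notin> dyadic j k \<Longrightarrow> v m = 0"
          "(\<Sum>m\<in>dyadic j k. x m * v m) = sum_norm p (dyadic j k) x" "sum_norm p' (dyadic j k) v \<le> 1"
        then show ?thesis by (intro exI[of _ v]) simp
      qed
    qed
    then obtain v where
      v: "\<And>j k m. m \<notin> dyadic j k \<Longrightarrow> v j k m = 0"
         "\<And>j k. (\<Sum>m\<in>dyadic j k. x m * v j k m) = sum_norm p (dyadic j k) x"
         "\<And>j k. sum_norm p' (dyadic j k) (v j k) \<le> 1"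
      by metis
    obtain c where c: "(\<Sum>jk\<in>S. local_norm x jk * c jk) = sum_norm r S (local_norm x)"
      "sum_norm r' S c \<le> 1"
      using sum_norm_dual_vector[OF S r rr'] .
    \<comment> \<open>the weight is the largest size that a block may have\<close>
    define b where "b = (\<lambda>(j, k) m. weight j * v j k m)"
    have b: "is_block q' p' (dyadic j k) (b (j, k))" for j k
      using v(1)[of _ j k] v(3)[of j k] p' by (simp add: is_block_iff b_def sum_norm_scale mult_left_le)
    let ?y = "\<lambda>m. \<Sum>jk\<in>S. c jk * b jk m"
    have y: "?y \<in> H" "normH ?y \<le> sum_norm r' S c"
      by (rule finite_block_sum_in_block_space[OF S b], rule finite_block_sum_norm_le[OF S b])
    define M where "M = (\<Union>jk\<in>S. dyadic (fst jk) (snd jk))"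
    have M: "finite M" using S by (simp add: M_def)
    have b_zero: "b jk m = 0" if "m \<notin> dyadic (fst jk) (snd jk)" for jk m
      using v(1) that by (simp add: b_def case_prod_beta)
    have xb: "(\<Sum>m\<in>M. x m * b jk m) = local_norm x jk" if "jk \<in> S" for jk
    proof -
      have "(\<Sum>m\<in>M. x m * b jk m) = (\<Sum>m\<in>dyadic (fst jk) (snd jk). x m * b jk m)"
        using M that b_zero by (intro sum.mono_neutral_right) (auto simp: M_def)
      also have "\<dots> = weight (fst jk) * (\<Sum>m\<in>dyadic (fst jk) (snd jk). x m * v (fst jk) (snd jk) m)"
        by (simp add: b_def case_prod_beta sum_distrib_left mult_ac)
      finally show ?thesis by (simp add: v(2) local_norm_def case_prod_beta)
    qed
    have "F ?y = (\<Sum>m\<in>M. ?y m * F (point_mass m))"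
    proof (rule functional_finite_support[OF F M])
      fix m assume "m \<notin> M"
      then show "?y m = 0" using b_zero by (intro sum.neutral) (auto simp: M_def)
    qed
    also have "\<dots> = (\<Sum>jk\<in>S. c jk * (\<Sum>m\<in>M. x m * b jk m))"
      unfolding sum_distrib_right sum_distrib_left
      by (subst sum.swap) (simp add: x_def mult_ac)
    also have "\<dots> = sum_norm r S (local_norm x)"
      using c(1) by (simp add: xb mult.commute)
    finally have "sum_norm r S (local_norm x) \<le> C * normH ?y"
      using C(2)[OF y(1)] by simp
    also have "\<dots> \<le> C * 1"
      using C(1) y(2) c(2) by (intro mult_left_mono) simp_all
    finally show ?thesis by simp
  qed
  have "0 < r" using r by simp
  then have "x \<in> X" "normX x \<le> C"
    unfolding bm_space_iff bm_norm_eq using lp_spaceI[OF _ *] lp_norm_leI[OF _ *] by simp_all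
  then show "(\<lambda>m. F (point_mass m)) \<in> X" "normX (\<lambda>m. F (point_mass m)) \<le> C"
    unfolding x_def by simp_all
qed

text \<open>
  Removing finitely many pieces leaves the tail of \<open>d\<close> as bound, so finite sums of pieces
  approximate \<open>y\<close> in the block norm.
\<close>

lemma decomposition_tail:
  assumes D: "decomposition d g y" and S: "finite S"
  shows "decomposition (\<lambda>jk. if jk \<in> S then 0 else d jk) (\<lambda>jk m. if jk \<in> S then 0 else g jk m)
    (\<lambda>m. y m - (\<Sum>jk\<in>S. g jk m))"
  unfolding decomposition_def
proof (intro conjI allI impI)
  note D' = D[unfolded decomposition_def]
  show "(\<lambda>jk. if jk \<in> S then 0 else d jk) \<in> lp_space r'"
    by (rule lp_space_mono[of r' d]) (use D' r' in simp_all)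
  show "0 \<le> (if jk \<in> S then 0 else d jk)" for jk using D' by (cases jk) simp
  fix j k m
  show "(if (j, k) \<in> S then 0 else g (j, k) m) = 0" if "m \<notin> dyadic j k" using D' that by simp
  show "sum_norm p' (dyadic j k) (\<lambda>m. if (j, k) \<in> S then 0 else g (j, k) m)
      \<le> (if (j, k) \<in> S then 0 else d (j, k)) * weight j"
    using D' by simp
  have "((\<lambda>jk. if jk \<in> S then - g jk m else 0) has_sum (- (\<Sum>jk\<in>S. g jk m))) UNIV"
    using S by (intro has_sum_finite_neutralI[of S]) (simp_all add: sum_negf)
  moreover have "((\<lambda>jk. g jk m) has_sum y m) UNIV" using D' by blast
  ultimately have "((\<lambda>jk. g jk m + (if jk \<in> S then - g jk m else 0)) has_sum
      (y m + - (\<Sum>jk\<in>S. g jk m))) UNIV"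
    by (rule has_sum_add[rotated])
  also have "(\<lambda>jk. g jk m + (if jk \<in> S then - g jk m else 0)) = (\<lambda>jk. if jk \<in> S then 0 else g jk m)"
    by auto
  finally show "((\<lambda>jk. if jk \<in> S then 0 else g jk m) has_sum (y m - (\<Sum>jk\<in>S. g jk m))) UNIV"
    by simp
qed

text \<open>
  Finite sums of pieces have finite support, so \<open>G\<close> vanishes on them, and they are dense.
\<close>

lemma functional_vanishes:
  assumes G: "bounded_functional_on H normH G" and zero: "\<And>m. G (point_mass m) = 0" and y: "y \<in> H"
  shows "G y = 0"
proof -
  obtain C where C: "\<And>z. z \<in> H \<Longrightarrow> \<bar>G z\<bar> \<le> C * normH z"
    using G unfolding bounded_functional_on_def by blast
  obtain d g where D: "decomposition d g y"
    using y unfolding block_space_iff by (elim exE)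
  note D' = D[unfolded decomposition_def]
  have "\<bar>G y\<bar> \<le> 0 + e" if e: "0 < e" for e
  proof -
    have pos: "0 < e / (\<bar>C\<bar> + 1)" using e by simp
    obtain S where S: "finite S" "lp_norm r' (\<lambda>jk. if jk \<in> S then 0 else d jk) < e / (\<bar>C\<bar> + 1)"
      using lp_norm_tail_small[of r' d, OF _ _ pos] D' r' by auto
    let ?t = "\<lambda>m. y m - (\<Sum>jk\<in>S. g jk m)"
    let ?s = "\<lambda>m. \<Sum>jk\<in>S. g jk m"
    note tail = decomposition_tail[OF D S(1)]
    have t: "?t \<in> H" using tail unfolding block_space_iff by (intro exI)
    \<comment> \<open>\<open>?s\<close> is \<open>y - ?t\<close>\<close>
    have "(\<lambda>m. (-1) * ?t m) \<in> H" by (rule fun_normed_space_scale[OF fun_normed_space_block t])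
    from fun_normed_space_add[OF fun_normed_space_block y this] have s: "?s \<in> H" by simp
    have "G ?s = (\<Sum>m\<in>(\<Union>jk\<in>S. dyadic (fst jk) (snd jk)). ?s m * G (point_mass m))"
    proof (rule functional_finite_support[OF G])
      fix m assume m: "m \<notin> (\<Union>jk\<in>S. dyadic (fst jk) (snd jk))"
      show "?s m = 0"
      proof (rule sum.neutral, rule ballI)
        fix jk assume "jk \<in> S"
        then show "g jk m = 0" using m D' by (cases jk) force
      qed
    qed (use S(1) in simp)
    then have "G ?s = 0" by (simp add: zero)
    moreover have "G (\<lambda>m. ?t m + ?s m) = G ?t + G ?s" by (rule bounded_functional_add[OF G t s])
    ultimately have "G y = G ?t" by simp
    also have "\<bar>G ?t\<bar> \<le> C * normH ?t" by (rule C[OF t])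
    also have "\<dots> \<le> (\<bar>C\<bar> + 1) * normH ?t"
      using block_norm_nonneg[OF t] by (intro mult_right_mono) simp_all
    also have "\<dots> \<le> (\<bar>C\<bar> + 1) * (e / (\<bar>C\<bar> + 1))"
      using block_norm_le[OF tail] S(2) by (intro mult_left_mono) simp_all
    also have "\<dots> = e"
      using abs_ge_zero[of C] by (simp add: field_simps)
    finally show ?thesis by simp
  qed
  then have "\<bar>G y\<bar> \<le> 0" by (rule field_le_epsilon)
  then show ?thesis by simp
qed

section \<open>The isometric isomorphism\<close>

abbreviation "L \<equiv> pairing_functional H"

lemma pairing_functional_apply: "y \<in> H \<Longrightarrow> L x y = (\<Sum>\<^sub>\<infinity>m. x m * y m)"
  by (simp add: pairing_functional_def)

lemma pairing_functional_point_mass [simp]: "L x (point_mass m) = x m"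
proof -
  have "((\<lambda>n. x n * point_mass m n) has_sum x m) UNIV"
    by (intro has_sum_finite_neutralI[of "{m}"]) (simp_all add: point_mass_def)
  then show ?thesis
    by (simp add: pairing_functional_apply[OF point_mass_in_block_space] infsumI)
qed

lemma pairing_functional_bounded:
  assumes x: "x \<in> X"
  shows "bounded_functional_on H normH (L x)"
  unfolding bounded_functional_on_def
proof (intro conjI ballI allI exI)
  fix y assume y: "y \<in> H"
  show "\<bar>L x y\<bar> \<le> normX x * normH y"
    using pairing_le[OF x y] by (simp add: pairing_functional_apply[OF y])
  show "L x (\<lambda>t. c * y t) = c * L x y" for c
    by (simp add: pairing_functional_apply y fun_normed_space_scale[OF fun_normed_space_block y]
        mult.left_commute infsum_cmult_right')
  fix z assume z: "z \<in> H"
  show "L x (\<lambda>t. y t + z t) = L x y + L x z"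
    using infsum_add[OF pairing_summable[OF x y] pairing_summable[OF x z]]
    by (simp add: pairing_functional_apply y z fun_normed_space_add[OF fun_normed_space_block y z]
        distrib_left)
qed

text \<open>
  One inequality is the boundedness of the pairing. The other is the decisive estimate for the
  functional \<open>L x\<close>, whose values on point masses are the entries of \<open>x\<close>.
\<close>

lemma dual_norm_pairing_functional:
  assumes x: "x \<in> X"
  shows "dual_norm H normH (L x) = normX x"
proof (rule antisym)
  have X: "0 \<le> normX x" by (simp add: bm_norm_eq)
  have "(\<lambda>_. 0) \<in> H" "normH (\<lambda>_. 0) = 0"
    using fun_normed_space_block unfolding fun_normed_space_def by blast+
  then have zero: "(\<lambda>_. 0) \<in> {y \<in> H. normH y \<le> 1}" by simp
  show "dual_norm H normH (L x) \<le> normX x"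
    unfolding dual_norm_def
  proof (rule cSUP_least)
    fix y assume "y \<in> {y \<in> H. normH y \<le> 1}"
    then have y: "y \<in> H" "normH y \<le> 1" by simp_all
    have "\<bar>L x y\<bar> \<le> normX x * normH y"
      using pairing_le[OF x y(1)] by (simp add: pairing_functional_apply[OF y(1)])
    also have "\<dots> \<le> normX x" using y(2) X by (simp add: mult_left_le)
    finally show "\<bar>L x y\<bar> \<le> normX x" .
  qed (use zero in blast)
  note F = pairing_functional_bounded[OF x]
  note bound = dual_norm_bound[OF fun_normed_space_block F]
  let ?e = "point_mass 0"
  have "\<bar>L x ?e\<bar> \<le> dual_norm H normH (L x) * normH ?e" by (rule bound[OF point_mass_in_block_space])
  moreover have "0 < normH ?e"
  proof -
    have "?e \<noteq> (\<lambda>_. 0)" by (auto simp: point_mass_def fun_eq_iff)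
    then show ?thesis
      using fun_normed_space_block point_mass_in_block_space[of 0]
      unfolding fun_normed_space_def by (simp add: order_less_le)
  qed
  ultimately have "0 \<le> dual_norm H normH (L x)"
    by (meson abs_ge_zero mult_neg_pos not_less order_trans)
  from functional_coefficients(2)[OF F this bound]
  show "normX x \<le> dual_norm H normH (L x)" by simp
qed

text \<open>
  The difference of \<open>F\<close> and \<open>L x\<close> is a bounded functional that vanishes on point masses.
\<close>

lemma functional_representation:
  assumes F: "bounded_functional_on H normH F"
  defines "x \<equiv> \<lambda>m. F (point_mass m)"
  shows "x \<in> X" "\<And>y. y \<in> H \<Longrightarrow> F y = L x y"
proof -
  obtain C where C: "\<And>y. y \<in> H \<Longrightarrow> \<bar>F y\<bar> \<le> C * normH y"
    using F unfolding bounded_functional_on_def by blast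
  have absC: "\<bar>F y\<bar> \<le> \<bar>C\<bar> * normH y" if "y \<in> H" for y
    using C[OF that] mult_right_mono[OF abs_ge_self block_norm_nonneg[OF that], of C] by linarith
  show x: "x \<in> X"
    unfolding x_def by (rule functional_coefficients(1)[OF F abs_ge_zero absC])
  note Lx = pairing_functional_bounded[OF x]
  have bound: "\<bar>L x y\<bar> \<le> normX x * normH y" if "y \<in> H" for y
    using pairing_le[OF x that] by (simp add: pairing_functional_apply[OF that])
  have G: "bounded_functional_on H normH (\<lambda>y. F y - L x y)"
    unfolding bounded_functional_on_def
  proof (intro conjI ballI allI exI)
    fix y assume y: "y \<in> H"
    show "\<bar>F y - L x y\<bar> \<le> (C + normX x) * normH y"
      using C[OF y] bound[OF y] by (simp add: distrib_right)
    show "F (\<lambda>t. c * y t) - L x (\<lambda>t. c * y t) = c * (F y - L x y)" for c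
      by (simp add: bounded_functional_scale[OF F y] bounded_functional_scale[OF Lx y] right_diff_distrib)
    show "F (\<lambda>t. y t + z t) - L x (\<lambda>t. y t + z t) = F y - L x y + (F z - L x z)" if "z \<in> H" for z
      by (simp add: bounded_functional_add[OF F y that] bounded_functional_add[OF Lx y that])
  qed
  show "F y = L x y" if "y \<in> H" for y
    using functional_vanishes[OF G _ that] by (simp add: x_def)
qed

lemma pairing_functional_linear: "fun_linear_on X L"
  unfolding fun_linear_on_def
proof (intro conjI ballI allI ext)
  fix x assume x: "x \<in> X"
  show "L (\<lambda>t. c * x t) y = c * L x y" for c y
    by (simp add: pairing_functional_def mult.assoc infsum_cmult_right')
  fix z assume z: "z \<in> X"
  show "L (\<lambda>t. x t + z t) y = L x y + L z y" for y
    using infsum_add[OF pairing_summable[OF x] pairing_summable[OF z], of y y]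
    by (simp add: pairing_functional_def distrib_right)
qed

lemma pairing_functional_inj: "inj L"
proof (rule injI)
  fix x z assume "L x = L z"
  then have "L x (point_mass m) = L z (point_mass m)" for m by simp
  then show "x = z" by (simp add: fun_eq_iff)
qed

lemma pairing_functional_image: "L ` X = dual_space H normH"
proof (intro equalityI subsetI)
  fix F assume "F \<in> L ` X"
  then obtain x where "x \<in> X" "F = L x" by blast
  then show "F \<in> dual_space H normH"
    using pairing_functional_bounded by (simp add: dual_space_def pairing_functional_def)
next
  fix F assume "F \<in> dual_space H normH"
  then have F: "bounded_functional_on H normH F" "\<And>y. y \<notin> H \<Longrightarrow> F y = 0"
    by (simp_all add: dual_space_def)
  have "F y = L (\<lambda>m. F (point_mass m)) y" for y
    using functional_representation(2)[OF F(1)] F(2) by (cases "y \<in> H") (simp_all add: pairing_functional_def)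
  then have "F = L (\<lambda>m. F (point_mass m))" by (rule ext)
  then show "F \<in> L ` X"
    using functional_representation(1)[OF F(1)] by (rule image_eqI)
qed

end

theorem theorem6p4:
  fixes p q r p' q' r' :: real
  assumes "1 < p" "p < q" "1 < r"
    and "1 / p + 1 / p' = 1" "1 / q + 1 / q' = 1" "1 / r + 1 / r' = 1"
  shows "fun_normed_space (block_space p' q' r') (block_norm p' q' r') \<and>
    (\<forall>x\<in>bm_space p q r. \<forall>y\<in>block_space p' q' r'. (\<lambda>m. x m * y m) summable_on UNIV) \<and>
    linear_isometric_isomorphism (bm_space p q r) (bm_norm p q r)
      (dual_space (block_space p' q' r') (block_norm p' q' r'))
      (dual_norm (block_space p' q' r') (block_norm p' q' r'))
      (pairing_functional (block_space p' q' r')) \<and>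
    (\<forall>F. bounded_functional_on (block_space p' q' r') (block_norm p' q' r') F \<longrightarrow>
      (\<exists>!x. x \<in> bm_space p q r \<and>
         (\<forall>y\<in>block_space p' q' r'. F y = (\<Sum>\<^sub>\<infinity>m. x m * y m)))) \<and>
    (\<forall>x\<in>bm_space p q r.
      dual_norm (block_space p' q' r') (block_norm p' q' r')
        (pairing_functional (block_space p' q' r') x) = bm_norm p q r x)"
proof -
  interpret bourgain_morrey_exponents p q r p' q' r'
    by standard (fact assms)+
  show ?thesis
  proof (intro conjI ballI allI impI)
    show "fun_normed_space H normH" by (rule fun_normed_space_block)
    show "linear_isometric_isomorphism X normX (dual_space H normH) (dual_norm H normH) L"
      unfolding linear_isometric_isomorphism_def
    proof (intro conjI ballI)
      show "fun_normed_space (dual_space H normH) (dual_norm H normH)"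
        unfolding pairing_functional_image[symmetric]
        by (rule fun_normed_space_image[of X normX L "dual_norm H normH",
              OF fun_normed_space_bm pairing_functional_linear dual_norm_pairing_functional])
      show "bij_betw L X (dual_space H normH)"
        unfolding bij_betw_def
        using inj_on_subset[OF pairing_functional_inj subset_UNIV] pairing_functional_image by blast
    qed (simp_all add: fun_normed_space_bm pairing_functional_linear dual_norm_pairing_functional)
    fix F assume F: "bounded_functional_on H normH F"
    show "\<exists>!x. x \<in> X \<and> (\<forall>y\<in>H. F y = (\<Sum>\<^sub>\<infinity>m. x m * y m))"
    proof (rule ex1I)
      show "(\<lambda>m. F (point_mass m)) \<in> X \<and> (\<forall>y\<in>H. F y = (\<Sum>\<^sub>\<infinity>m. F (point_mass m) * y m))"
        using functional_representation[OF F] by (simp add: pairing_functional_apply)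
      fix x assume "x \<in> X \<and> (\<forall>y\<in>H. F y = (\<Sum>\<^sub>\<infinity>m. x m * y m))"
      then have "F (point_mass m) = L x (point_mass m)" for m
        using pairing_functional_apply[OF point_mass_in_block_space] point_mass_in_block_space by metis
      then show "x = (\<lambda>m. F (point_mass m))" by simp
    qed
  qed (simp_all add: pairing_summable dual_norm_pairing_functional)
qed

end
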